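(* Let $A\in\mathbb R^{m\times d}$, $b\in\mathbb R^m$, $\mathcal X=\{x\in\mathbb R^d: Ax\le b\}$, and consider the problem $\min_{x\in\mathcal X} f(x)$ with $f(x)=g(x)+q^Tx$, where $g:\mathbb R^d\to\mathbb R$ is differentiable (and such that $f$ satisfies the standing smoothness assumption in the context). Suppose the vector $q\in\mathbb R^d$ is generated from a continuous measure. Then, with probability one, for every KKT point $x^*$ of the problem such that the rows $\{A_j: j\in\mathcal A(x^* )\}$ are linearly independent, the strict complementarity condition holds at $x^*$.
   Context: $A_j$ is the $j$th row of $A$ and $\mathcal A(x)=\{j\in[m]: A_jx=b_j\}$ is the active set. A KKT point is $x^*\in\mathcal X$ for which there is $\mu^*\in\mathbb R^m$, $\mu^*\ge0$, with $\nabla f(x^* )+\sum_{j=1}^m\mu_j^*A_j^T=0$ and $\mu^*_j(A_jx^*-b_j)=0$ for all $j$; $(x^*,\mu^* )$ is then a KKT pair. Strict complementarity (SC) holds for a KKT pair $(x^*,\mu^* )$ if for each $j\in[m]$ either $\mu_j^*>0$ and $A_jx^*=b_j$, or $\mu_j^*=0$ and $A_jx^*<b_j$. SC holds at $x^*$ if it holds for the KKT pairs $(x^*,\mu^* )$. "Generated from a continuous measure" means that the law of $q$ is absolutely continuous with respect to Lebesgue measure on $\mathbb R^d$. Standing assumption: $f$ is twice differentiable with $\|\nabla f(x)-\nabla f(y)\|\le L_1\|x-y\|$ and $\|\nabla^2 f(x)-\nabla^2 f(y)\|\le L_2\|x-y\|$ for all $x,y\in\mathcal X$. *)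

theory Defs
  imports "HOL-Probability.Probability"
begin

(* The description is meaningful only where f is differentiable; the gradient is then unique. *)
definition gradient :: "(real ^ 'd \<Rightarrow> real) \<Rightarrow> real ^ 'd \<Rightarrow> real ^ 'd" where
  "gradient f x = (THE D. GDERIV f x :> D)"

definition hessian :: "(real ^ 'd \<Rightarrow> real) \<Rightarrow> real ^ 'd \<Rightarrow> real ^ 'd ^ 'd" where
  "hessian f x = jacobian (gradient f) (at x)"

(* Differentiability is required on the whole space, the Lipschitz bounds only on X.
   Hessians are compared in the operator (spectral) norm. *)
definition smoothness_assumption ::
    "real \<Rightarrow> real \<Rightarrow> (real ^ 'd) set \<Rightarrow> (real ^ 'd \<Rightarrow> real) \<Rightarrow> bool" where
  "smoothness_assumption L1 L2 X f \<longleftrightarrow>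
     (\<forall>x. f differentiable (at x)) \<and>
     (\<forall>x. gradient f differentiable (at x)) \<and>
     (\<forall>x\<in>X. \<forall>y\<in>X. norm (gradient f x - gradient f y) \<le> L1 * norm (x - y)) \<and>
     (\<forall>x\<in>X. \<forall>y\<in>X. onorm (\<lambda>v. (hessian f x - hessian f y) *v v) \<le> L2 * norm (x - y))"

definition polyhedron_set :: "real ^ 'd ^ 'm \<Rightarrow> real ^ 'm \<Rightarrow> (real ^ 'd) set" where
  "polyhedron_set A b = {x. \<forall>j. (A *v x) $ j \<le> b $ j}"

definition active_set :: "real ^ 'd ^ 'm \<Rightarrow> real ^ 'm \<Rightarrow> real ^ 'd \<Rightarrow> 'm set" where
  "active_set A b x = {j. (A *v x) $ j = b $ j}"

definition KKT_pair ::
    "real ^ 'd ^ 'm \<Rightarrow> real ^ 'm \<Rightarrow> (real ^ 'd \<Rightarrow> real) \<Rightarrow> real ^ 'd \<Rightarrow> real ^ 'm \<Rightarrow> bool" where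
  "KKT_pair A b f x \<mu> \<longleftrightarrow>
     x \<in> polyhedron_set A b \<and>
     (\<forall>j. 0 \<le> \<mu> $ j) \<and>
     gradient f x + (\<Sum>j\<in>UNIV. \<mu> $ j *\<^sub>R row j A) = 0 \<and>
     (\<forall>j. \<mu> $ j * ((A *v x) $ j - b $ j) = 0)"

definition KKT_point ::
    "real ^ 'd ^ 'm \<Rightarrow> real ^ 'm \<Rightarrow> (real ^ 'd \<Rightarrow> real) \<Rightarrow> real ^ 'd \<Rightarrow> bool" where
  "KKT_point A b f x \<longleftrightarrow> (\<exists>\<mu>. KKT_pair A b f x \<mu>)"

definition strict_complementarity_pair ::
    "real ^ 'd ^ 'm \<Rightarrow> real ^ 'm \<Rightarrow> real ^ 'd \<Rightarrow> real ^ 'm \<Rightarrow> bool" where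
  "strict_complementarity_pair A b x \<mu> \<longleftrightarrow>
     (\<forall>j. (\<mu> $ j > 0 \<and> (A *v x) $ j = b $ j) \<or> (\<mu> $ j = 0 \<and> (A *v x) $ j < b $ j))"

definition strict_complementarity_at ::
    "real ^ 'd ^ 'm \<Rightarrow> real ^ 'm \<Rightarrow> (real ^ 'd \<Rightarrow> real) \<Rightarrow> real ^ 'd \<Rightarrow> bool" where
  "strict_complementarity_at A b f x \<longleftrightarrow>
     (\<forall>\<mu>. KKT_pair A b f x \<mu> \<longrightarrow> strict_complementarity_pair A b x \<mu>)"

(* Linear independence of the rows as a family indexed by J: independence of the set of rows
   alone would not notice a row that occurs twice. *)
definition rows_independent :: "real ^ 'd ^ 'm \<Rightarrow> 'm set \<Rightarrow> bool" where
  "rows_independent A J \<longleftrightarrow> inj_on (\<lambda>j. row j A) J \<and> independent ((\<lambda>j. row j A) ` J)"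

definition objective :: "(real ^ 'd \<Rightarrow> real) \<Rightarrow> real ^ 'd \<Rightarrow> real ^ 'd \<Rightarrow> real" where
  "objective g q x = g x + q \<bullet> x"

end

theory Submission
  imports Defs
begin

text \<open>
  If strict complementarity fails at a KKT pair, some active constraint \<open>k\<close> has multiplier \<open>0\<close>,
  so \<open>q = - \<nabla>g(x) - (\<Sum>j\<in>J - {k}. \<mu>\<^sub>j A\<^sub>j)\<close> with \<open>J\<close> the active set. Here \<open>x\<close> ranges over an
  affine space of dimension \<open>d - |J|\<close> and there are \<open>|J| - 1\<close> free multipliers. Hence \<open>q\<close> lies
  in the image of a hyperplane under a differentiable map from \<open>\<real>\<^sup>d\<close> to itself, which is a null
  set, and there are only finitely many choices of \<open>J\<close> and \<open>k\<close>.
\<close>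

text \<open>Riesz representation: the coordinates of \<open>D\<close> are the values of the
  derivative on \<open>Basis\<close>.\<close>

lemma GDERIV_exists:
  fixes f :: "'a::euclidean_space \<Rightarrow> real"
  assumes "f differentiable (at x)"
  shows "\<exists>D. GDERIV f x :> D"
proof -
  obtain f' where f': "(f has_derivative f') (at x)"
    using assms by (auto simp: differentiable_def)
  interpret linear f' using f' by (rule has_derivative_linear)
  have "f' h = h \<bullet> (\<Sum>i\<in>Basis. f' i *\<^sub>R i)" for h
  proof -
    have "f' h = f' (\<Sum>i\<in>Basis. (h \<bullet> i) *\<^sub>R i)"
      by (simp add: euclidean_representation)
    also have "\<dots> = (\<Sum>i\<in>Basis. (h \<bullet> i) * f' i)"
      by (simp add: sum scale)
    finally show ?thesis
      by (simp add: inner_sum_right mult.commute)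
  qed
  then have "f' = (\<lambda>h. h \<bullet> (\<Sum>i\<in>Basis. f' i *\<^sub>R i))" by blast
  with f' show ?thesis unfolding gderiv_def by metis
qed

lemma GDERIV_unique:
  fixes f :: "'a::real_inner \<Rightarrow> real"
  assumes "GDERIV f x :> D" "GDERIV f x :> E"
  shows "D = E"
proof -
  have "(\<lambda>h. h \<bullet> D) = (\<lambda>h. h \<bullet> E)"
    using assms unfolding gderiv_def by (rule has_derivative_unique)
  then have "\<forall>h. h \<bullet> D = h \<bullet> E" by (rule fun_cong[THEN allI])
  then show ?thesis by (simp only: vector_eq_ldot)
qed

lemma gradient_eq:
  assumes "GDERIV f x :> D"
  shows "gradient f x = D"
  unfolding gradient_def using assms by (rule the_equality) (rule GDERIV_unique[OF _ assms])

lemma gradient_objective: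
  assumes "g differentiable (at x)"
  shows "gradient (objective g q) x = gradient g x + q"
proof -
  obtain D where D: "GDERIV g x :> D" using GDERIV_exists[OF assms] by blast
  have "GDERIV (objective g q) x :> D + q"
    using D unfolding gderiv_def objective_def
    by (auto intro!: derivative_eq_intros simp: inner_add_right inner_commute)
  then show ?thesis using gradient_eq D by metis
qed

text \<open>The map is expansion in an orthonormal basis of \<open>S\<close>. With \<open>S\<close>
  the span of the active rows, \<open>P\<close> separates combinations of these rows from
  displacements that keep the active equalities.\<close>

lemma orthogonal_projection_exists:
  fixes S :: "'a::euclidean_space set"
  assumes "subspace S"
  obtains P where "linear P" "\<And>y. y \<in> S \<Longrightarrow> P y = y"
    "\<And>y. (\<And>s. s \<in> S \<Longrightarrow> s \<bullet> y = 0) \<Longrightarrow> P y = 0"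
proof -
  obtain B where B: "B \<subseteq> S" "pairwise orthogonal B" "\<And>e. e \<in> B \<Longrightarrow> norm e = 1"
    "independent B" "span B = S"
    using orthonormal_basis_subspace[OF assms] by metis
  show thesis
  proof
    show "linear (\<lambda>y. \<Sum>e\<in>B. (e \<bullet> y) *\<^sub>R e)"
      by (intro linear_compose_sum ballI linearI) (simp_all add: inner_add_right scaleR_add_left)
    show "(\<Sum>e\<in>B. (e \<bullet> y) *\<^sub>R e) = y" if "y \<in> S" for y
      using orthonormal_basis_expand[OF B(2,3), of y] that B(5) independent_imp_finite[OF B(4)]
      by (simp add: inner_commute)
    show "(\<Sum>e\<in>B. (e \<bullet> y) *\<^sub>R e) = 0" if "\<And>s. s \<in> S \<Longrightarrow> s \<bullet> y = 0" for y
      using that B(1) by (auto intro!: sum.neutral)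
  qed
qed

text \<open>With \<open>G\<close> the gradient of \<open>g\<close>, these are the shifts for which
  stationarity holds at a point satisfying the equalities in \<open>J\<close>, with no contribution
  from \<open>k\<close>. The signs of \<open>c\<close> and the constraints outside \<open>J\<close>
  are dropped, which can only enlarge the set.\<close>

definition degenerate_shifts ::
    "('i \<Rightarrow> 'a) \<Rightarrow> ('i \<Rightarrow> real) \<Rightarrow> ('a \<Rightarrow> 'a) \<Rightarrow> 'i set \<Rightarrow> 'i \<Rightarrow> 'a::real_inner set" where
  "degenerate_shifts a b G J k =
     {- G x - (\<Sum>j\<in>J - {k}. c j *\<^sub>R a j) | x c. \<forall>j\<in>J. a j \<bullet> x = b j}"

lemma negligible_degenerate_shifts:
  fixes a :: "'i \<Rightarrow> 'a::euclidean_space"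
  assumes G: "\<And>x. G differentiable (at x)"
    and inj: "inj_on a J" and indep: "independent (a ` J)" and k: "k \<in> J"
  shows "negligible (degenerate_shifts a b G J k)"
proof (cases "\<exists>x0. \<forall>j\<in>J. a j \<bullet> x0 = b j")
  case False
  then have "degenerate_shifts a b G J k = {}" by (auto simp: degenerate_shifts_def)
  then show ?thesis by simp
next
  case True
  then obtain x0 where x0: "\<And>j. j \<in> J \<Longrightarrow> a j \<bullet> x0 = b j" by blast
  define W where "W = span (a ` J)"
  define T where "T = span (a ` (J - {k}))"
  have TW: "T \<subseteq> W" unfolding T_def W_def by (intro span_mono) auto
  \<comment> \<open>By injectivity, deleting \<open>k\<close> from \<open>J\<close> deletes the
    vector \<open>a k\<close> from the image, so independence applies.\<close>
  have akT: "a k \<notin> T"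
    using indep k inj_on_image_set_diff[OF inj, of J "{k}"]
    unfolding T_def dependent_def by auto
  \<comment> \<open>The part \<open>u\<close> of \<open>a k\<close> orthogonal to \<open>T\<close>
    is nonzero and lies in \<open>W\<close>. It is therefore orthogonal both to \<open>T\<close> and
    to the orthogonal complement of \<open>W\<close>, and serves as the normal of the
    hyperplane.\<close>
  obtain t u where t: "t \<in> T" and u: "\<And>w. w \<in> T \<Longrightarrow> orthogonal u w" and tu: "a k = t + u"
    unfolding T_def using orthogonal_subspace_decomp_exists by metis
  have "u \<noteq> 0" using akT t tu by auto
  have "u = a k - t" using tu by simp
  moreover have "a k \<in> W" unfolding W_def using k by (auto intro: span_base)
  moreover have "t \<in> W" using t TW by blast
  ultimately have uW: "u \<in> W" unfolding W_def by (simp add: span_diff)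
  obtain P where P: "linear P" "\<And>y. y \<in> W \<Longrightarrow> P y = y"
    "\<And>y. (\<And>s. s \<in> W \<Longrightarrow> s \<bullet> y = 0) \<Longrightarrow> P y = 0"
    using orthogonal_projection_exists[of W] unfolding W_def by (metis subspace_span)
  \<comment> \<open>One vector \<open>y\<close> encodes both parameters: \<open>y - P y\<close> is
    the displacement of the point from \<open>x0\<close>, and \<open>P y\<close> is the combination
    of rows.\<close>
  define F where "F = (\<lambda>y. - G (x0 + (y - P y)) - P y)"
  have dP: "P differentiable (at y)" for y
    using P(1) linear_imp_differentiable by blast
  have "(G \<circ> (\<lambda>y. x0 + (y - P y))) differentiable (at y)" for y
    by (intro differentiable_chain_at G differentiable_add differentiable_diff dP) auto
  then have "F differentiable (at y)" for y
    unfolding F_def by (intro differentiable_diff differentiable_minus dP) (simp add: o_def)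
  then have "F differentiable_on {y. u \<bullet> y = 0}"
    by (simp add: differentiable_at_imp_differentiable_on)
  \<comment> \<open>Differentiable maps of a Euclidean space to itself send null sets to null sets.
    Continuity of \<open>G\<close> alone would not give this.\<close>
  then have "negligible (F ` {y. u \<bullet> y = 0})"
    using \<open>u \<noteq> 0\<close> by (intro negligible_differentiable_image_negligible negligible_hyperplane) auto
  moreover have "degenerate_shifts a b G J k \<subseteq> F ` {y. u \<bullet> y = 0}"
  proof
    fix p assume "p \<in> degenerate_shifts a b G J k"
    then obtain x c where x: "\<And>j. j \<in> J \<Longrightarrow> a j \<bullet> x = b j"
      and p: "p = - G x - (\<Sum>j\<in>J - {k}. c j *\<^sub>R a j)"
      unfolding degenerate_shifts_def by blast
    define w where "w = (\<Sum>j\<in>J - {k}. c j *\<^sub>R a j)"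
    have wT: "w \<in> T" unfolding w_def T_def by (intro span_sum span_scale span_base imageI)
    have "orthogonal (x - x0) s" if "s \<in> W" for s
      using that unfolding W_def
      by (rule orthogonal_to_span)
        (auto simp: orthogonal_def inner_diff_left inner_commute[of _ "a _"] x x0)
    then have perp: "s \<bullet> (x - x0) = 0" if "s \<in> W" for s
      using that by (simp add: orthogonal_def inner_commute)
    \<comment> \<open>The preimage of \<open>p\<close> is \<open>x - x0 + w\<close>: the projection
      kills \<open>x - x0\<close>, which is orthogonal to \<open>W\<close>, and fixes
      \<open>w\<close>, which lies in \<open>W\<close>.\<close>
    have "P (x - x0 + w) = w"
      using P(2)[of w] P(3)[of "x - x0"] perp wT TW by (auto simp: linear_add[OF P(1)])
    then have "F (x - x0 + w) = p" unfolding F_def p w_def[symmetric] by simp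
    moreover have "u \<bullet> (x - x0 + w) = 0"
      using perp[OF uW] u[OF wT] by (simp add: inner_add_right orthogonal_def)
    ultimately show "p \<in> F ` {y. u \<bullet> y = 0}" by blast
  qed
  ultimately show ?thesis by (rule negligible_subset)
qed

lemma not_strict_complementarity_imp_degenerate:
  assumes g: "g differentiable (at x)"
    and kkt: "KKT_pair A b (objective g q) x \<mu>"
    and nsc: "\<not> strict_complementarity_pair A b x \<mu>"
  obtains k where "k \<in> active_set A b x"
    "q \<in> degenerate_shifts (\<lambda>j. row j A) (\<lambda>j. b $ j) (gradient g) (active_set A b x) k"
proof -
  let ?J = "active_set A b x"
  from kkt have le: "\<And>j. (A *v x) $ j \<le> b $ j" and nn: "\<And>j. 0 \<le> \<mu> $ j"
    and stat: "gradient (objective g q) x + (\<Sum>j\<in>UNIV. \<mu> $ j *\<^sub>R row j A) = 0"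
    and compl: "\<And>j. \<mu> $ j * ((A *v x) $ j - b $ j) = 0"
    unfolding KKT_pair_def polyhedron_set_def by auto
  from nsc obtain k where
    "\<not> (\<mu> $ k > 0 \<and> (A *v x) $ k = b $ k)" "\<not> (\<mu> $ k = 0 \<and> (A *v x) $ k < b $ k)"
    unfolding strict_complementarity_pair_def by blast
  \<comment> \<open>Complementarity makes the multiplier or the slack at \<open>k\<close> vanish. If
    only one vanished, the sign of the other would give one of the two excluded
    alternatives.\<close>
  with le[of k] nn[of k] compl[of k] have k: "(A *v x) $ k = b $ k" "\<mu> $ k = 0"
    by auto
  \<comment> \<open>Off the active set the multipliers vanish by complementarity, at
    \<open>k\<close> by its choice.\<close>
  have "\<mu> $ j = 0" if "j \<notin> ?J - {k}" for j
    using that compl[of j] k by (auto simp: active_set_def)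
  then have "(\<Sum>j\<in>UNIV. \<mu> $ j *\<^sub>R row j A) = (\<Sum>j\<in>?J - {k}. \<mu> $ j *\<^sub>R row j A)"
    by (intro sum.mono_neutral_right) auto
  with stat have "q = - gradient g x - (\<Sum>j\<in>?J - {k}. \<mu> $ j *\<^sub>R row j A)"
    unfolding gradient_objective[OF g] by (simp add: algebra_simps eq_neg_iff_add_eq_0)
  moreover have "\<forall>j\<in>?J. row j A \<bullet> x = b $ j"
    by (simp add: active_set_def row_def matrix_vector_mul_component)
  ultimately have "q \<in> degenerate_shifts (\<lambda>j. row j A) (\<lambda>j. b $ j) (gradient g) ?J k"
    unfolding degenerate_shifts_def mem_Collect_eq
    by (intro exI[of _ x] exI[of _ "\<lambda>j. \<mu> $ j"] conjI)
  moreover have "k \<in> ?J" using k(1) by (simp add: active_set_def)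
  ultimately show thesis using that by simp
qed

text \<open>Negligible sets need only be Lebesgue measurable, while the law of \<open>q\<close>
  lives on Borel sets. The set is therefore first covered by a Borel null set
  \<open>N'\<close>.\<close>

lemma AE_notin_negligible:
  fixes q :: "'w \<Rightarrow> 'a::euclidean_space"
  assumes q: "q \<in> borel_measurable M"
    and ac: "absolutely_continuous lborel (distr M borel q)"
    and N: "negligible N"
  shows "AE \<omega> in M. q \<omega> \<notin> N"
proof -
  have "N \<in> null_sets (completion lborel)"
    using N by (simp add: negligible_iff_null_sets)
  then obtain N' where N': "N' \<in> null_sets lborel" "N \<subseteq> N'"
    unfolding null_sets_completion_iff2 by blast
  then have "N' \<in> null_sets (distr M borel q)"
    using ac unfolding absolutely_continuous_def by blast
  then have "AE y in distr M borel q. y \<notin> N'" by (rule AE_not_in)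
  then have "AE \<omega> in M. q \<omega> \<notin> N'" by (rule AE_distrD[OF q])
  then show ?thesis by (rule eventually_mono) (use N'(2) in blast)
qed

theorem proposition2:
  fixes A :: "real ^ 'd ^ 'm" and b :: "real ^ 'm"
    and g :: "real ^ 'd \<Rightarrow> real" and L1 L2 :: real
    and M :: "'w measure" and q :: "'w \<Rightarrow> real ^ 'd"
  assumes "\<And>x. g differentiable (at x)"
    and "prob_space M"
    and "q \<in> borel_measurable M"
    and "absolutely_continuous lborel (distr M borel q)"
    and "\<And>\<omega>. \<omega> \<in> space M \<Longrightarrow>
           smoothness_assumption L1 L2 (polyhedron_set A b) (objective g (q \<omega>))"
  shows "AE \<omega> in M. \<forall>x. KKT_point A b (objective g (q \<omega>)) x \<and>
           rows_independent A (active_set A b x) \<longrightarrow>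
           strict_complementarity_at A b (objective g (q \<omega>)) x"
proof -
  \<comment> \<open>Smoothness is assumed of the shifted objectives. A single outcome suffices to
    transfer it to \<open>g\<close>, since the two gradients differ by a constant; a probability
    space has such an outcome.\<close>
  obtain \<omega>0 where "\<omega>0 \<in> space M"
    using prob_space.not_empty[OF assms(2)] by blast
  then have "gradient (objective g (q \<omega>0)) differentiable (at x)" for x
    using assms(5) unfolding smoothness_assumption_def by blast
  moreover have "gradient (objective g (q \<omega>0)) = (\<lambda>x. gradient g x + q \<omega>0)"
    using gradient_objective assms(1) by blast
  ultimately have "(\<lambda>x. gradient g x + q \<omega>0 - q \<omega>0) differentiable (at x)" for x
    by (intro differentiable_diff) auto
  then have G: "gradient g differentiable (at x)" for x by simp
  \<comment> \<open>\<open>N\<close> depends neither on the outcome nor on \<open>x\<close>, so one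
    exceptional event serves all KKT points at once, although there may be uncountably many. The
    union is finite because the index type of the rows is.\<close>
  define N where "N = (\<Union>(J, k) \<in> {(J, k). rows_independent A J \<and> k \<in> J}.
    degenerate_shifts (\<lambda>j. row j A) (\<lambda>j. b $ j) (gradient g) J k)"
  have "negligible N"
    unfolding N_def
    by (intro negligible_Union)
      (auto simp: rows_independent_def intro!: negligible_degenerate_shifts G)
  then have "AE \<omega> in M. q \<omega> \<notin> N"
    using assms(3,4) by (intro AE_notin_negligible)
  then show ?thesis
  proof (rule eventually_mono, intro allI impI)
    fix \<omega> x
    assume notN: "q \<omega> \<notin> N"
      and x: "KKT_point A b (objective g (q \<omega>)) x \<and> rows_independent A (active_set A b x)"
    show "strict_complementarity_at A b (objective g (q \<omega>)) x"
      unfolding strict_complementarity_at_def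
    proof (intro allI impI, rule ccontr)
      fix \<mu>
      assume "KKT_pair A b (objective g (q \<omega>)) x \<mu>" "\<not> strict_complementarity_pair A b x \<mu>"
      with assms(1) obtain k where "k \<in> active_set A b x"
        "q \<omega> \<in> degenerate_shifts (\<lambda>j. row j A) (\<lambda>j. b $ j) (gradient g) (active_set A b x) k"
        by (rule not_strict_complementarity_imp_degenerate)
      then have "q \<omega> \<in> N" unfolding N_def using x by auto
      with notN show False by contradiction
    qed
  qed
qed

end
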